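(* Let $(\Omega,\Sigma,\mu)$ be a probability space and let $f\in L_\infty[\mu]$ be real-valued. Then for every $\beta>0$ $$S_f(\beta)=\int_0^\beta\int_t^\beta\sigma_{sf}^2[f]\,\mathrm{d}s\,\mathrm{d}t .$$
   Context: Write $E[g]=\int_\Omega g\,\mathrm{d}\mu$. For $\beta\in\mathbb{R}$ and $g\in L_\infty[\mu]$: the thermal expectation is $E_{\beta f}[g]=E[g\,\mathrm{e}^{\beta f}]/E[\mathrm{e}^{\beta f}]$; the thermal variance is $\sigma_{\beta f}^2[g]=E_{\beta f}[(g-E_{\beta f}[g])^2]$; the canonical entropy is $S_f(\beta)=\beta E_{\beta f}[f]-\ln E[\mathrm{e}^{\beta f}]$. *)

theory Defs
  imports "HOL-Probability.Probability"
begin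

text \<open>The elements of \<open>L_\<infinity>[\<mu>]\<close> are represented by functions rather than by classes of
  almost everywhere equal functions; every notion below depends only on the class.\<close>

definition L_infty :: "'a measure \<Rightarrow> ('a \<Rightarrow> real) set" where
  "L_infty M = {f \<in> borel_measurable M. \<exists>C. AE x in M. \<bar>f x\<bar> \<le> C}"

text \<open>The exponent is a function \<open>h\<close>, so that \<open>E_{\<beta>f}[g]\<close> is the case \<open>h = (\<lambda>x. \<beta> * f x)\<close>.\<close>

definition thermal_expectation :: "'a measure \<Rightarrow> ('a \<Rightarrow> real) \<Rightarrow> ('a \<Rightarrow> real) \<Rightarrow> real" where
  "thermal_expectation M h g = (\<integral>x. g x * exp (h x) \<partial>M) / (\<integral>x. exp (h x) \<partial>M)"

definition thermal_variance :: "'a measure \<Rightarrow> ('a \<Rightarrow> real) \<Rightarrow> ('a \<Rightarrow> real) \<Rightarrow> real" where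
  "thermal_variance M h g = thermal_expectation M h (\<lambda>x. (g x - thermal_expectation M h g)\<^sup>2)"

definition canonical_entropy :: "'a measure \<Rightarrow> ('a \<Rightarrow> real) \<Rightarrow> real \<Rightarrow> real" where
  "canonical_entropy M f \<beta> =
     \<beta> * thermal_expectation M (\<lambda>x. \<beta> * f x) f - ln (\<integral>x. exp (\<beta> * f x) \<partial>M)"

end

theory Submission
  imports Defs
begin

text \<open>With \<open>Z(s) = E[exp(s f)]\<close> and \<open>U(s) = E_{sf}[f]\<close>, differentiation under the integral sign
  gives \<open>(ln Z)' = U\<close> and \<open>U' = \<sigma>\<^sup>2_{sf}[f]\<close>. Hence the inner integral is \<open>U(\<beta>) - U(t)\<close>, and since
  \<open>ln Z(0) = 0\<close> the outer one is \<open>\<beta> U(\<beta>) - ln Z(\<beta>) = S_f(\<beta>)\<close>.\<close>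

lemma L_inftyE:
  assumes "f \<in> L_infty M"
  obtains C where "C \<ge> 0" "f \<in> borel_measurable M" "AE x in M. \<bar>f x\<bar> \<le> C"
proof -
  from assms obtain C where C: "f \<in> borel_measurable M" "AE x in M. \<bar>f x\<bar> \<le> C"
    by (auto simp: L_infty_def)
  from C(2) have "AE x in M. \<bar>f x\<bar> \<le> max C 0" by eventually_elim auto
  with C(1) show thesis by (intro that[of "max C 0"]) auto
qed

lemma L_infty_mult:
  assumes "f \<in> L_infty M" "g \<in> L_infty M"
  shows "(\<lambda>x. f x * g x) \<in> L_infty M"
proof -
  obtain C where C: "C \<ge> 0" "f \<in> borel_measurable M" "AE x in M. \<bar>f x\<bar> \<le> C"
    using assms(1) by (rule L_inftyE)
  obtain D where D: "D \<ge> 0" "g \<in> borel_measurable M" "AE x in M. \<bar>g x\<bar> \<le> D"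
    using assms(2) by (rule L_inftyE)
  from C(3) D(3) have "AE x in M. \<bar>f x * g x\<bar> \<le> C * D"
    by eventually_elim (use C(1) in \<open>auto simp: abs_mult intro!: mult_mono\<close>)
  with C(2) D(2) show ?thesis by (auto simp: L_infty_def)
qed

lemma L_infty_const: "(\<lambda>x. c) \<in> L_infty M"
  by (auto simp: L_infty_def)

text \<open>If \<open>\<bar>f\<bar> \<le> C\<close> almost everywhere, the exponent is at most
  \<open>\<bar>s\<bar> * C\<close> whatever the sign of \<open>s\<close>. Together with closure
  under products this makes every weighted integrand below integrable for all real
  \<open>s\<close>.\<close>

lemma L_infty_exp:
  assumes "f \<in> L_infty M"
  shows "(\<lambda>x. exp (s * f x)) \<in> L_infty M"
proof -
  obtain C where C: "C \<ge> 0" "f \<in> borel_measurable M" "AE x in M. \<bar>f x\<bar> \<le> C"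
    using assms by (rule L_inftyE)
  from C(3) have "AE x in M. \<bar>exp (s * f x)\<bar> \<le> exp (\<bar>s\<bar> * C)"
  proof eventually_elim
    case (elim x)
    have "s * f x \<le> \<bar>s\<bar> * \<bar>f x\<bar>" by (metis abs_ge_self abs_mult)
    also have "\<dots> \<le> \<bar>s\<bar> * C" using elim by (intro mult_left_mono) auto
    finally show ?case by simp
  qed
  moreover have "(\<lambda>x. exp (s * f x)) \<in> borel_measurable M" using C(2) by measurable
  ultimately show ?thesis unfolding L_infty_def by blast
qed

context prob_space
begin

lemma integrable_L_infty: "f \<in> L_infty M \<Longrightarrow> integrable M f"
  unfolding L_infty_def using integrable_const_bound[of f] by auto

lemma integrable_L_infty_exp:
  assumes "f \<in> L_infty M" "g \<in> L_infty M"
  shows "integrable M (\<lambda>x. g x * exp (s * f x))"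
  by (intro integrable_L_infty L_infty_mult L_infty_exp assms)

lemma expectation_exp_pos:
  assumes "f \<in> L_infty M"
  shows "expectation (\<lambda>x. exp (s * f x)) > 0"
proof -
  have int: "integrable M (\<lambda>x. exp (s * f x))"
    by (intro integrable_L_infty L_infty_exp assms)
  \<comment> \<open>A vanishing integral would force the exponential to be zero almost everywhere,
    which is impossible on a space of mass one.\<close>
  have "expectation (\<lambda>x. exp (s * f x)) \<noteq> 0"
    by (subst integral_nonneg_eq_0_iff_AE[OF int]) auto
  moreover have "expectation (\<lambda>x. exp (s * f x)) \<ge> 0" by simp
  ultimately show ?thesis by linarith
qed

text \<open>The second-order Taylor remainder of \<open>exp\<close> is bounded almost everywhere by
  a constant times \<open>h\<^sup>2\<close>, so the difference quotient misses its limit by at most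
  a constant times \<open>\<bar>h\<bar>\<close>. The weight \<open>g\<close> lets one statement
  cover the partition function (\<open>g = 1\<close>) and the first and second moments.\<close>

lemma has_field_derivative_expectation_exp:
  assumes "f \<in> L_infty M" "g \<in> L_infty M"
  shows "((\<lambda>s. expectation (\<lambda>x. g x * exp (s * f x))) has_field_derivative
           expectation (\<lambda>x. g x * f x * exp (s * f x))) (at s)"
proof -
  define G where "G = (\<lambda>s. expectation (\<lambda>x. g x * exp (s * f x)))"
  define G' where "G' = expectation (\<lambda>x. g x * f x * exp (s * f x))"
  obtain C where C: "C \<ge> 0" "f \<in> borel_measurable M" "AE x in M. \<bar>f x\<bar> \<le> C"
    using assms(1) by (rule L_inftyE)
  obtain D where D: "D \<ge> 0" "AE x in M. \<bar>g x * exp (s * f x)\<bar> \<le> D"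
    using L_infty_mult[OF assms(2) L_infty_exp[OF assms(1)]] by (rule L_inftyE)
  \<comment> \<open>\<open>D\<close> bounds the weight \<open>g x * exp (s * f x)\<close>;
    \<open>exp C * C\<^sup>2\<close> bounds the Taylor remainder of \<open>exp (h * f x)\<close>
    divided by \<open>h\<^sup>2\<close>. Requiring \<open>\<bar>h\<bar> < 1\<close> below keeps
    \<open>\<bar>h * f x\<bar> \<le> C\<close>, so \<open>K\<close> does not depend on
    \<open>h\<close>.\<close>
  define K where "K = D * (exp C * C\<^sup>2)"
  note integ = integrable_L_infty_exp[OF assms(1) assms(2)]
    integrable_L_infty_exp[OF assms(1) L_infty_mult[OF assms(2,1)]]
  have quot: "\<bar>(G (s + h) - G s) / h - G'\<bar> \<le> K * \<bar>h\<bar>" if h: "h \<noteq> 0" "\<bar>h\<bar> < 1" for h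
  proof -
    let ?r = "\<lambda>x. g x * exp ((s + h) * f x) - g x * exp (s * f x) - h * (g x * f x * exp (s * f x))"
    have "AE x in M. \<bar>?r x\<bar> \<le> K * h\<^sup>2"
      using C(3) D(2)
    proof eventually_elim
      case (elim x)
      have hf: "\<bar>h * f x\<bar> \<le> \<bar>h\<bar> * C"
        using elim by (auto simp: abs_mult intro: mult_left_mono)
      also have "\<dots> \<le> C" using h C(1) by (simp add: mult_left_le_one_le)
      finally have hf': "\<bar>h * f x\<bar> \<le> C" .
      have "\<bar>exp (h * f x) - (1 + h * f x)\<bar> \<le> exp \<bar>h * f x\<bar> * \<bar>h * f x\<bar>\<^sup>2"
        using Taylor_exp_field[of "h * f x" 1] by (simp add: power2_eq_square)
      also have "\<dots> \<le> exp C * (\<bar>h\<bar> * C)\<^sup>2"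
        using hf hf' by (intro mult_mono power_mono) auto
      finally have e: "\<bar>exp (h * f x) - (1 + h * f x)\<bar> \<le> exp C * (\<bar>h\<bar> * C)\<^sup>2" .
      have "?r x = g x * exp (s * f x) * (exp (h * f x) - (1 + h * f x))"
        by (simp add: algebra_simps exp_add)
      also have "\<bar>\<dots>\<bar> \<le> D * (exp C * (\<bar>h\<bar> * C)\<^sup>2)"
        unfolding abs_mult[of "g x * exp (s * f x)"] using e elim D(1) by (intro mult_mono) auto
      also have "\<dots> = K * h\<^sup>2" by (simp add: K_def power_mult_distrib)
      finally show ?case .
    qed
    \<comment> \<open>Since the total mass is one, a constant bound passes to the expectation
      unchanged.\<close>
    then have "\<bar>expectation ?r\<bar> \<le> K * h\<^sup>2"
      using integ by (intro order_trans[OF integral_abs_bound] integral_le_const) auto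
    moreover have "expectation ?r = G (s + h) - G s - h * G'"
      using integ by (simp add: G_def G'_def)
    ultimately have "\<bar>G (s + h) - G s - h * G'\<bar> / \<bar>h\<bar> \<le> K * h\<^sup>2 / \<bar>h\<bar>"
      by (intro divide_right_mono) auto
    moreover have "(G (s + h) - G s) / h - G' = (G (s + h) - G s - h * G') / h"
      using h by (simp add: field_simps)
    moreover have "h\<^sup>2 / \<bar>h\<bar> = \<bar>h\<bar>"
      using h by (auto simp: power2_eq_square abs_if)
    ultimately show ?thesis
      by (metis abs_divide times_divide_eq_right)
  qed
  have "((\<lambda>h. (G (s + h) - G s) / h - G') \<longlongrightarrow> 0) (at 0)"
  proof (rule Lim_null_comparison)
    show "\<forall>\<^sub>F h in at 0. norm ((G (s + h) - G s) / h - G') \<le> K * \<bar>h\<bar>"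
      unfolding eventually_at by (rule exI[of _ 1]) (auto intro: quot)
    show "((\<lambda>h. K * \<bar>h\<bar>) \<longlongrightarrow> 0) (at 0)"
      by (auto intro!: tendsto_eq_intros)
  qed
  then show ?thesis
    unfolding DERIV_def LIM_zero_iff G_def G'_def by (simp add: LIM_zero_iff)
qed

lemma has_field_derivative_log_partition:
  assumes "f \<in> L_infty M"
  shows "((\<lambda>s. ln (expectation (\<lambda>x. exp (s * f x)))) has_field_derivative
           thermal_expectation M (\<lambda>x. s * f x) f) (at s)"
  using has_field_derivative_expectation_exp[OF assms L_infty_const[of 1], of s]
    expectation_exp_pos[OF assms, of s]
  by (auto intro!: derivative_eq_intros simp: thermal_expectation_def)

text \<open>The quotient rule; the derivative is the thermal covariance of \<open>g\<close> and
  \<open>f\<close>. The case \<open>g = f\<close> differentiates the mean, and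
  \<open>g = f * f\<close> later yields continuity of the second moment.\<close>

lemma has_field_derivative_thermal_expectation:
  assumes "f \<in> L_infty M" "g \<in> L_infty M"
  shows "((\<lambda>s. thermal_expectation M (\<lambda>x. s * f x) g) has_field_derivative
           thermal_expectation M (\<lambda>x. s * f x) (\<lambda>x. g x * f x) -
           thermal_expectation M (\<lambda>x. s * f x) g * thermal_expectation M (\<lambda>x. s * f x) f) (at s)"
proof -
  have "((\<lambda>s. expectation (\<lambda>x. exp (s * f x))) has_field_derivative
          expectation (\<lambda>x. f x * exp (s * f x))) (at s)"
    using has_field_derivative_expectation_exp[OF assms(1) L_infty_const[of 1], of s] by simp
  from DERIV_divide[OF has_field_derivative_expectation_exp[OF assms] this]
    expectation_exp_pos[OF assms(1), of s]
  show ?thesis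
    unfolding thermal_expectation_def by (simp add: diff_divide_distrib)
qed

text \<open>Expand the square around the constant \<open>u\<close> and use \<open>uZ\<close> on the
  cross term. This form matches the covariance from the quotient rule and makes continuity in
  \<open>s\<close> accessible.\<close>

lemma thermal_variance_eq:
  assumes "f \<in> L_infty M" "g \<in> L_infty M"
  shows "thermal_variance M (\<lambda>x. s * f x) g =
    thermal_expectation M (\<lambda>x. s * f x) (\<lambda>x. g x * g x) - (thermal_expectation M (\<lambda>x. s * f x) g)\<^sup>2"
proof -
  define u where "u = thermal_expectation M (\<lambda>x. s * f x) g"
  define Z where "Z = expectation (\<lambda>x. exp (s * f x))"
  have Z: "Z > 0" unfolding Z_def by (rule expectation_exp_pos[OF assms(1)])
  note integ = integrable_L_infty_exp[OF assms, of s]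
    integrable_L_infty_exp[OF assms(1) L_infty_mult[OF assms(2,2)], of s]
    integrable_L_infty[OF L_infty_exp[OF assms(1)], of s]
  have uZ: "expectation (\<lambda>x. g x * exp (s * f x)) = u * Z"
    using Z by (simp add: u_def thermal_expectation_def Z_def)
  have "expectation (\<lambda>x. (g x - u)\<^sup>2 * exp (s * f x)) =
      expectation (\<lambda>x. g x * g x * exp (s * f x) - 2 * u * (g x * exp (s * f x)) + u\<^sup>2 * exp (s * f x))"
    by (simp add: power2_eq_square algebra_simps)
  also have "\<dots> = expectation (\<lambda>x. g x * g x * exp (s * f x)) - u\<^sup>2 * Z"
    using integ uZ by (simp add: Z_def power2_eq_square)
  finally show ?thesis
    using Z unfolding thermal_variance_def u_def[symmetric]
    by (simp add: thermal_expectation_def Z_def[symmetric] diff_divide_distrib)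
qed

end

text \<open>The fundamental theorem of calculus for oriented integrals: with no order imposed on
  \<open>a\<close> and \<open>b\<close>, the inner integral can be evaluated at every real
  \<open>t\<close>, not only for \<open>t \<le> \<beta>\<close>.\<close>

lemma interval_integral_eq_diff_of_has_field_derivative:
  fixes f F :: "real \<Rightarrow> real"
  assumes "\<And>x. isCont f x" "\<And>x. (F has_field_derivative f x) (at x)"
  shows "(LBINT x=ereal a..ereal b. f x) = F b - F a"
proof (rule interval_integral_FTC_finite)
  show "continuous_on {min a b..max a b} f"
    using assms(1) by (intro continuous_at_imp_continuous_on) auto
  show "(F has_vector_derivative f x) (at x within {min a b..max a b})" for x
    using assms(2) by (auto simp: has_real_derivative_iff_has_vector_derivative
        intro: has_vector_derivative_at_within)
qed

theorem theorem3:
  fixes M :: "'a measure" and f :: "'a \<Rightarrow> real" and \<beta> :: real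
  assumes "prob_space M"
    and "f \<in> L_infty M"
    and "\<beta> > 0"
  shows "canonical_entropy M f \<beta> =
    (LBINT t=0..\<beta>. (LBINT s=t..\<beta>. thermal_variance M (\<lambda>x. s * f x) f))"
proof -
  interpret prob_space M by fact
  note f = assms(2)
  define U where "U = (\<lambda>s. thermal_expectation M (\<lambda>x. s * f x) f)"
  define V where "V = (\<lambda>s. thermal_variance M (\<lambda>x. s * f x) f)"
  define L where "L = (\<lambda>s. ln (expectation (\<lambda>x. exp (s * f x))))"
  have L: "(L has_field_derivative U s) (at s)" for s
    unfolding L_def U_def by (rule has_field_derivative_log_partition[OF f])
  have U: "(U has_field_derivative V s) (at s)" for s
    using has_field_derivative_thermal_expectation[OF f f, of s]
    unfolding U_def V_def by (simp add: thermal_variance_eq[OF f f] power2_eq_square)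
  have contU: "isCont U s" for s
    using U by (rule DERIV_isCont)
  \<comment> \<open>The fundamental theorem is applied to a continuous integrand. Here
    \<open>V\<close> is the second moment minus \<open>U\<^sup>2\<close>, and both terms are
    differentiable in \<open>s\<close>.\<close>
  have contV: "isCont V s" for s
    unfolding V_def thermal_variance_eq[OF f f] U_def[unfolded fun_eq_iff, rule_format, symmetric]
    by (intro continuous_intros contU
        DERIV_isCont[OF has_field_derivative_thermal_expectation[OF f L_infty_mult[OF f f]]])
  have "(LBINT s=ereal t..ereal \<beta>. V s) = U \<beta> - U t" for t
    by (rule interval_integral_eq_diff_of_has_field_derivative[OF contV U])
  then have "(LBINT t=0..\<beta>. (LBINT s=t..\<beta>. V s)) = (LBINT t=ereal 0..ereal \<beta>. U \<beta> - U t)"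
    by (simp add: zero_ereal_def)
  \<comment> \<open>With \<open>U \<beta>\<close> constant in \<open>t\<close>, the antiderivative
    is \<open>t * U \<beta> - L t\<close>.\<close>
  also have "\<dots> = (\<beta> * U \<beta> - L \<beta>) - (0 * U \<beta> - L 0)"
    by (rule interval_integral_eq_diff_of_has_field_derivative)
      (auto intro!: continuous_intros contU derivative_eq_intros L)
  \<comment> \<open>Normalization of \<open>M\<close> gives \<open>L 0 = ln 1 = 0\<close>.\<close>
  also have "\<dots> = canonical_entropy M f \<beta>"
    by (simp add: canonical_entropy_def L_def U_def prob_space)
  finally show ?thesis by (simp add: V_def)
qed

end
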